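(* Let $\mathcal{T}=(T_t)_{t\in\mathbb{R}}$ be an ergodic and aperiodic measure-preserving flow on a standard Borel probability space $(X,\mathcal{B},\mu)$. Assume that for some real sequence $(q_n)$ $$\mu_{T_{2q_n},T_{q_n}}\to\int_{\mathbb{R}^2}\mu_{T_{-t},T_{-u}}\,dQ(t,u)$$ for some Borel probability measure $Q$ on $\mathbb{R}^2$. If $Q$ is not invariant under $\theta(t,u)=(t,t-u)$, then $\mathcal{T}$ is not isomorphic to its inverse. In particular, if $(0,x)\in\mathbb{R}^2$ is an atom of $Q$ but $(0,-x)$ is not, then $\mathcal{T}$ is not isomorphic to its inverse.
   Context: Aperiodic: for every $t\ne0$, $\mu(\{x:T_tx=x\})=0$. For $S_1,S_2$ commuting with the flow, $\mu_{S_1,S_2}$ is the measure on $X^3$ with $\mu_{S_1,S_2}(A_1\times A_2\times A_3)=\mu(S_1^{-1}A_1\cap S_2^{-1}A_2\cap A_3)$. Convergence of such self-joinings means convergence of the values on every product set $A_1\times A_2\times A_3$, $A_i\in\mathcal{B}$; integrals of measures are defined setwise. $\mathcal{T}$ is isomorphic to its inverse if there is an invertible measure-preserving $S:X\to X$ with $T_t\circ S=S\circ T_{-t}$ for all $t\in\mathbb{R}$. *)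

theory Defs
  imports "HOL-Probability.Probability"
begin

(* The carrier is space M, not the whole type, so the Polish topology is taken on space M. *)
definition standard_borel :: "'a measure \<Rightarrow> bool" where
  "standard_borel M \<longleftrightarrow>
     (\<exists>X. completely_metrizable_space X \<and> second_countable X \<and> topspace X = space M \<and>
          sets M = sigma_sets (space M) {U. openin X U})"

definition measure_preserving :: "'a measure \<Rightarrow> ('a \<Rightarrow> 'a) \<Rightarrow> bool" where
  "measure_preserving M S \<longleftrightarrow> S \<in> measurable M M \<and> distr M M S = M"

(* Joint measurability is part of the notion of a flow; it makes the integrands t \<mapsto> \<mu>(...)
   measurable. *)
definition measure_preserving_flow :: "'a measure \<Rightarrow> (real \<Rightarrow> 'a \<Rightarrow> 'a) \<Rightarrow> bool" where
  "measure_preserving_flow M T \<longleftrightarrow>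
     (\<lambda>(t, x). T t x) \<in> measurable (borel \<Otimes>\<^sub>M M) M \<and>
     (\<forall>x\<in>space M. T 0 x = x) \<and>
     (\<forall>s t. \<forall>x\<in>space M. T (s + t) x = T s (T t x)) \<and>
     (\<forall>t. measure_preserving M (T t))"

definition ergodic_flow :: "'a measure \<Rightarrow> (real \<Rightarrow> 'a \<Rightarrow> 'a) \<Rightarrow> bool" where
  "ergodic_flow M T \<longleftrightarrow>
     (\<forall>A\<in>sets M. (\<forall>t. T t -` A \<inter> space M = A) \<longrightarrow> measure M A = 0 \<or> measure M A = 1)"

definition aperiodic_flow :: "'a measure \<Rightarrow> (real \<Rightarrow> 'a \<Rightarrow> 'a) \<Rightarrow> bool" where
  "aperiodic_flow M T \<longleftrightarrow> (\<forall>t. t \<noteq> 0 \<longrightarrow> {x \<in> space M. T t x = x} \<in> null_sets M)"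

definition self_joining ::
    "'a measure \<Rightarrow> ('a \<Rightarrow> 'a) \<Rightarrow> ('a \<Rightarrow> 'a) \<Rightarrow> ('a \<times> 'a \<times> 'a) measure" where
  "self_joining M S1 S2 = distr M (M \<Otimes>\<^sub>M M \<Otimes>\<^sub>M M) (\<lambda>x. (S1 x, S2 x, x))"

lemma measure_self_joining:
  assumes [measurable]: "S1 \<in> measurable M M" "S2 \<in> measurable M M"
    and [measurable]: "A1 \<in> sets M" "A2 \<in> sets M" "A3 \<in> sets M"
  shows "measure (self_joining M S1 S2) (A1 \<times> A2 \<times> A3) =
         measure M ((S1 -` A1 \<inter> space M) \<inter> (S2 -` A2 \<inter> space M) \<inter> A3)"
proof -
  have "(\<lambda>x. (S1 x, S2 x, x)) -` (A1 \<times> A2 \<times> A3) \<inter> space M =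
        (S1 -` A1 \<inter> space M) \<inter> (S2 -` A2 \<inter> space M) \<inter> A3"
    using sets.sets_into_space[OF assms(5)] by auto
  then show ?thesis
    unfolding self_joining_def by (subst measure_distr) auto
qed

(* Maps are identified when they agree almost everywhere, as usual for isomorphisms of
   measure-preserving systems: S is invertible modulo null sets and each of the intertwining
   relations holds almost everywhere. *)
definition isomorphic_to_inverse :: "'a measure \<Rightarrow> (real \<Rightarrow> 'a \<Rightarrow> 'a) \<Rightarrow> bool" where
  "isomorphic_to_inverse M T \<longleftrightarrow>
     (\<exists>S S'. measure_preserving M S \<and> S' \<in> measurable M M \<and>
        (AE x in M. S' (S x) = x) \<and> (AE x in M. S (S' x) = x) \<and>
        (\<forall>t. AE x in M. T t (S x) = S (T (- t) x)))"

(* An everywhere defined reversing automorphism is a special case. *)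
lemma isomorphic_to_inverseI:
  assumes "measure_preserving M S" "bij_betw S (space M) (space M)"
    and "the_inv_into (space M) S \<in> measurable M M"
    and "\<And>t x. x \<in> space M \<Longrightarrow> T t (S x) = S (T (- t) x)"
  shows "isomorphic_to_inverse M T"
proof -
  have "AE x in M. the_inv_into (space M) S (S x) = x"
    using assms(2) by (intro AE_I2) (auto simp: bij_betw_def the_inv_into_f_f)
  moreover have "AE x in M. S (the_inv_into (space M) S x) = x"
    using assms(2) by (intro AE_I2) (auto simp: f_the_inv_into_f_bij_betw)
  moreover have "\<forall>t. AE x in M. T t (S x) = S (T (- t) x)"
    using assms(4) by (auto intro: AE_I2)
  ultimately show ?thesis
    unfolding isomorphic_to_inverse_def using assms(1,3) by blast
qed

end

theory Submission
  imports Defs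
begin

text \<open>
  Write \<open>triple a b A1 A2 A3\<close> for the value of the joining given by the maps \<open>T a\<close> and \<open>T b\<close> on
  a product set. A reversing automorphism \<open>S\<close> turns \<open>triple a b\<close>, evaluated at the images of the
  sets, into \<open>triple (- a) (- b)\<close>, and for \<open>(a, b) = (2 q, q)\<close> invariance of the measure under
  \<open>T (2 q)\<close> turns the latter into \<open>triple (2 q) q\<close> with the outer sets exchanged. In the limit
  this shows that \<open>Q\<close> and its image under \<open>(t, u) \<mapsto> (t, t - u)\<close> define the same mixture of graph
  joinings.

  A mixture of graph joinings determines its mixing measure \<open>Q\<close>: disintegrating over the third
  coordinate, for almost every \<open>x\<close> the image of \<open>Q\<close> under \<open>(t, u) \<mapsto> (T t x, T u x)\<close> is
  determined, and this Borel map is injective, since almost every \<open>x\<close> has trivial stabilizer. The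
  stabilizer of \<open>x\<close> is closed, so the sets of points having a period in a given compact interval
  are measurable; they are invariant, so by ergodicity a positive measure for one of them would, by
  nested intervals, yield a single common period, against aperiodicity.
\<close>

section \<open>Finite Borel measures on Polish spaces and separating families\<close>

lemma compact_inner_approx:
  fixes N :: "'a::polish_space measure"
  assumes "finite_measure N" and N: "sets N = sets borel" and B: "B \<in> sets borel" and "0 < e"
  obtains K where "compact K" "K \<subseteq> B" "measure N (B - K) < e"
proof -
  interpret finite_measure N by fact
  have *: "emeasure N B = (SUP K\<in>{K. K \<subseteq> B \<and> compact K}. emeasure N K)"
    using N B by (intro inner_regular) auto
  have "\<exists>K. K \<subseteq> B \<and> compact K \<and> measure N B - e < measure N K"
  proof (rule ccontr)
    assume "\<not> ?thesis"
    then have le: "measure N K \<le> measure N B - e" if "K \<subseteq> B" "compact K" for K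
      using that by force
    \<comment> \<open>The empty compact set shows that the bound is nonnegative, so
      \<open>ennreal\<close> does not truncate it.\<close>
    have "0 \<le> measure N B - e"
      using le[of "{}"] by simp
    have "emeasure N B \<le> ennreal (measure N B - e)"
      unfolding * by (rule SUP_least) (auto simp: emeasure_eq_measure le intro!: ennreal_leI)
    then show False
      using \<open>0 < e\<close> \<open>0 \<le> measure N B - e\<close> by (simp add: emeasure_eq_measure)
  qed
  then obtain K where K: "K \<subseteq> B" "compact K" "measure N B - e < measure N K" by blast
  have "K \<in> sets N" using N K(2) by (simp add: borel_compact)
  then have "measure N (B - K) < e"
    using K N B finite_measure_Diff[of B K] by simp
  with K that show thesis by blast
qed

text \<open>
  On a closed set of almost full measure all members of the countable family are relatively clopen.
  There the complement of a compact set \<open>F\<close> is, by compactness, the union of the members of the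
  family that avoid \<open>F\<close>, so no appeal to the Lusin--Souslin theorem is needed.
\<close>
lemma borel_measure_eqI_separating:
  fixes N1 N2 :: "'a::polish_space measure"
  assumes fin: "finite_measure N1" "finite_measure N2"
    and N: "sets N1 = sets borel" "sets N2 = sets borel"
    and \<G>: "countable \<G>" "\<G> \<subseteq> sets borel" "Int_stable \<G>" "UNIV \<in> \<G>"
    and sep: "\<And>y z. y \<noteq> z \<Longrightarrow> \<exists>G\<in>\<G>. y \<in> G \<and> z \<notin> G"
    and eq: "\<And>G. G \<in> \<G> \<Longrightarrow> measure N1 G = measure N2 G"
  shows "N1 = N2"
proof -
  interpret N1: finite_measure N1 by fact
  interpret N2: finite_measure N2 by fact
  note [simp] = N
  have sp: "space N1 = UNIV" "space N2 = UNIV"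
    using sets_eq_imp_space_eq[OF N(1)] sets_eq_imp_space_eq[OF N(2)] by auto
  have pow: "\<G> \<subseteq> Pow UNIV" by simp
  \<comment> \<open>A Dynkin argument gives agreement on the sigma-algebra generated by
    \<open>\<G>\<close>. It is not known at this point to contain all Borel sets; the rest of the
    proof places enough compact sets in it.\<close>
  have sig: "measure N1 A = measure N2 A \<and> A \<in> sets borel" if "A \<in> sigma_sets UNIV \<G>" for A
    using \<G>(3) pow that
  proof (induction rule: sigma_sets_induct_disjoint)
    case (compl A)
    then have "measure N1 (space N1 - A) = measure N2 (space N2 - A)"
      using eq[OF \<G>(4)] sp by (subst N1.finite_measure_compl, simp, subst N2.finite_measure_compl) simp_all
    with compl show ?case by (simp add: sp borel_comp flip: Compl_eq_Diff_UNIV)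
  next
    case (union A)
    have "(\<lambda>i. measure N1 (A i)) sums measure N1 (\<Union>i. A i)"
      using union by (intro N1.finite_measure_UNION) auto
    moreover have "(\<lambda>i. measure N2 (A i)) sums measure N2 (\<Union>i. A i)"
      using union by (intro N2.finite_measure_UNION) auto
    ultimately show ?case using union by (auto simp: sums_iff)
  qed (use eq \<G> in auto)
  define E where "E = from_nat_into \<G>"
  have rangeE: "range E = \<G>" unfolding E_def using \<G> by (intro range_from_nat_into) auto
  then have E: "E n \<in> \<G>" "E n \<in> sets borel" for n using \<G> by auto
  have approx: "\<exists>K. closed K \<and> measure N1 (- K) \<le> e \<and> measure N2 (- K) \<le> e \<and>
      (\<forall>F. compact F \<and> F \<subseteq> K \<longrightarrow> measure N1 F = measure N2 F)" if "0 < e" for e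
  proof -
    \<comment> \<open>Each index \<open>n\<close> loses two pieces, one inside \<open>E n\<close>
      and one inside its complement, hence the extra halving: the losses \<open>2 * d n\<close> add
      up to \<open>e\<close>.\<close>
    define d where "d n = e * (1/2) ^ Suc n / 2" for n :: nat
    have d: "0 < d n" for n using that by (simp add: d_def)
    have both: "\<exists>C. closed C \<and> C \<subseteq> B \<and> measure N1 (B - C) < d n \<and> measure N2 (B - C) < d n"
      if B: "B \<in> sets borel" for B n
    proof -
      obtain C1 where C1: "compact C1" "C1 \<subseteq> B" "measure N1 (B - C1) < d n"
        using compact_inner_approx[OF fin(1) N(1) B d] .
      obtain C2 where C2: "compact C2" "C2 \<subseteq> B" "measure N2 (B - C2) < d n"
        using compact_inner_approx[OF fin(2) N(2) B d] .
      have [measurable]: "C1 \<in> sets borel" "C2 \<in> sets borel"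
        using C1 C2 by (auto simp: borel_compact)
      have "measure N1 (B - (C1 \<union> C2)) \<le> measure N1 (B - C1)"
        using B by (intro N1.finite_measure_mono) auto
      moreover have "measure N2 (B - (C1 \<union> C2)) \<le> measure N2 (B - C2)"
        using B by (intro N2.finite_measure_mono) auto
      ultimately show ?thesis
        using C1 C2 by (intro exI[of _ "C1 \<union> C2"]) (auto simp: compact_imp_closed)
    qed
    have "\<exists>C. \<forall>n. closed (C n) \<and> C n \<subseteq> E n \<and> measure N1 (E n - C n) < d n \<and> measure N2 (E n - C n) < d n"
      using both E by (intro choice) auto
    then obtain C where C: "closed (C n)" "C n \<subseteq> E n"
        "measure N1 (E n - C n) < d n" "measure N2 (E n - C n) < d n" for n by blast
    have "\<exists>D. \<forall>n. closed (D n) \<and> D n \<subseteq> - E n \<and> measure N1 (- E n - D n) < d n \<and> measure N2 (- E n - D n) < d n"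
      using both E by (intro choice) auto
    then obtain D where D: "closed (D n)" "D n \<subseteq> - E n"
        "measure N1 (- E n - D n) < d n" "measure N2 (- E n - D n) < d n" for n by blast
    have CD: "C n \<in> sets borel" "D n \<in> sets borel" for n
      using C D by auto
    define L where "L n = (E n - C n) \<union> (- E n - D n)" for n
    have L: "L n \<in> sets borel" for n using E CD by (auto simp: L_def)
    have dsum: "(\<lambda>n. 2 * d n) sums e"
      using sums_mult[OF power_half_series, of e] by (simp add: d_def)
    \<comment> \<open>On \<open>K\<close> the set \<open>E n\<close> coincides with the closed set
      \<open>C n\<close> and its complement with the closed set \<open>D n\<close>, so every
      \<open>E n\<close> is relatively clopen in \<open>K\<close>.\<close>
    define K where "K = (\<Inter>n. C n \<union> D n)"
    have K: "closed K" unfolding K_def using C D by (intro closed_INT) auto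
    have KL: "- K = (\<Union>n. L n)"
      using C(2) D(2) unfolding K_def L_def by blast
    have m1: "measure N1 (L n) \<le> 2 * d n" "measure N2 (L n) \<le> 2 * d n" for n
      using measure_Un_le[of "E n - C n" N1 "- E n - D n"] measure_Un_le[of "E n - C n" N2 "- E n - D n"]
        E[of n] CD[of n] C(3,4)[of n] D(3,4)[of n]
      by (simp_all add: L_def borel_comp sets.Diff)
    have s: "summable (\<lambda>n. measure N1 (L n))" "summable (\<lambda>n. measure N2 (L n))"
      by (rule summable_comparison_test[OF _ sums_summable[OF dsum]]; use m1 in auto)+
    have "measure N1 (- K) \<le> (\<Sum>n. measure N1 (L n))" "measure N2 (- K) \<le> (\<Sum>n. measure N2 (L n))"
      unfolding KL using L s
      by (auto intro!: N1.finite_measure_subadditive_countably N2.finite_measure_subadditive_countably)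
    moreover have "(\<Sum>n. measure N1 (L n)) \<le> e" "(\<Sum>n. measure N2 (L n)) \<le> e"
      using suminf_le[OF m1(1) s(1) sums_summable[OF dsum]] suminf_le[OF m1(2) s(2) sums_summable[OF dsum]]
        sums_unique[OF dsum] by auto
    moreover have "measure N1 F = measure N2 F" if F: "compact F" "F \<subseteq> K" for F
    proof -
      have FE: "F \<inter> E n \<subseteq> C n" for n using F(2) D(2)[of n] by (auto simp: K_def)
      have "\<exists>G\<in>\<G>. y \<in> G \<and> G \<inter> F = {}" if y: "y \<notin> F" for y
      proof -
        \<comment> \<open>A member of the family that contains \<open>y\<close> but not
          \<open>z\<close> also has \<open>z\<close> outside the smaller closed set
          \<open>C n\<close>. These open complements therefore cover \<open>F\<close>, and a finite
          subcover yields a finite intersection of sets \<open>E n\<close> that contains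
          \<open>y\<close> and misses \<open>F\<close>.\<close>
        have "F \<subseteq> \<Union> ((\<lambda>n. - C n) ` {n. y \<in> E n})"
        proof
          fix z assume "z \<in> F"
          with y have "y \<noteq> z" by auto
          from sep[OF this] rangeE obtain n where "y \<in> E n" "z \<notin> E n" by auto
          then show "z \<in> \<Union> ((\<lambda>n. - C n) ` {n. y \<in> E n})" using C(2)[of n] by auto
        qed
        then obtain I where I: "finite I" "I \<subseteq> {n. y \<in> E n}" "F \<subseteq> \<Union> ((\<lambda>n. - C n) ` I)"
          using compactE_image[OF F(1), of "{n. y \<in> E n}" "\<lambda>n. - C n"] C(1) by (metis open_Compl)
        \<comment> \<open>The empty index set, which can occur when \<open>F\<close> is empty, is
          covered by \<open>UNIV \<in> \<G>\<close>.\<close>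
        have "(\<Inter>n\<in>J. E n) \<in> \<G>" if "finite J" for J
          using that by induction (use \<G> E in \<open>auto dest: Int_stableD\<close>)
        moreover have "(\<Inter>n\<in>I. E n) \<inter> F = {}" using I(3) FE by blast
        ultimately show ?thesis using I(1,2) by (intro bexI[of _ "\<Inter>n\<in>I. E n"]) auto
      qed
      then have "- F = \<Union> {G\<in>\<G>. G \<inter> F = {}}" by blast
      moreover have "\<Union> {G\<in>\<G>. G \<inter> F = {}} \<in> sigma_sets UNIV \<G>"
        using \<G>(1) by (intro sigma_sets_UNION) (auto intro: countable_subset)
      ultimately have "UNIV - (- F) \<in> sigma_sets UNIV \<G>" by (metis sigma_sets.Compl)
      then show ?thesis using sig by (simp add: Diff_Compl)
    qed
    ultimately show ?thesis using K by (intro exI[of _ K]) auto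
  qed
  have close: "\<bar>measure N1 F - measure N2 F\<bar> \<le> e" if F: "compact F" and "0 < e" for F e
  proof -
    obtain K where K: "closed K" "measure N1 (- K) \<le> e" "measure N2 (- K) \<le> e"
       "\<And>F. compact F \<Longrightarrow> F \<subseteq> K \<Longrightarrow> measure N1 F = measure N2 F"
      using approx[OF \<open>0 < e\<close>] by blast
    have [measurable]: "F \<in> sets borel" "K \<in> sets borel" using F K by (auto simp: borel_compact)
    have FK: "compact (F \<inter> K)" using F K by (simp add: compact_Int_closed)
    have "measure N1 F \<le> measure N1 (F \<inter> K) + measure N1 (- K)"
      by (rule order_trans[OF N1.finite_measure_mono measure_Un_le]) auto
    moreover have "measure N2 F \<le> measure N2 (F \<inter> K) + measure N2 (- K)"
      by (rule order_trans[OF N2.finite_measure_mono measure_Un_le]) auto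
    moreover have "measure N1 (F \<inter> K) \<le> measure N1 F" "measure N2 (F \<inter> K) \<le> measure N2 F"
      by (auto intro!: N1.finite_measure_mono N2.finite_measure_mono)
    ultimately show ?thesis using K(2,3) K(4)[OF FK] by auto
  qed
  \<comment> \<open>A nonzero difference would be at most half of itself.\<close>
  have cpt: "measure N1 F = measure N2 F" if "compact F" for F
    using close[OF that, of "\<bar>measure N1 F - measure N2 F\<bar> / 2"] by force
  show ?thesis
  proof (rule measure_eqI)
    fix B assume "B \<in> sets N1"
    then have B: "B \<in> sets borel" by simp
    have "emeasure N1 B = (SUP K\<in>{K. K \<subseteq> B \<and> compact K}. emeasure N1 K)"
      using B sp by (intro inner_regular) auto
    also have "\<dots> = (SUP K\<in>{K. K \<subseteq> B \<and> compact K}. emeasure N2 K)"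
      by (intro SUP_cong) (auto simp: N1.emeasure_eq_measure N2.emeasure_eq_measure cpt)
    also have "\<dots> = emeasure N2 B"
      using B sp by (intro inner_regular[symmetric]) auto
    finally show "emeasure N1 B = emeasure N2 B" .
  qed simp
qed

section \<open>Preliminaries on the real line and on standard Borel spaces\<close>

text \<open>This replaces a quantifier over an uncountable interval by countable operations, which
  preserve measurability. Near a common zero rational points satisfy any finite number of strict
  conditions; conversely approximate zeros stay in a compact interval and accumulate at a true
  one.\<close>

lemma common_zero_iff_rational_approx:
  fixes h :: "'b::countable \<Rightarrow> real \<Rightarrow> real"
  assumes h: "\<And>j. continuous_on UNIV (h j)"
  shows "(\<exists>c\<in>{p..r}. \<forall>j. h j c = 0) \<longleftrightarrow>
    (\<forall>k::nat. \<exists>c::rat. p - 1 / Suc k < of_rat c \<and> of_rat c < r + 1 / Suc k \<and>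
      (\<forall>j. to_nat j \<le> k \<longrightarrow> \<bar>h j (of_rat c)\<bar> < 1 / Suc k))"
    (is "?L \<longleftrightarrow> (\<forall>k. ?R k)")
proof
  assume ?L
  then obtain c where c: "p \<le> c" "c \<le> r" "\<And>j. h j c = 0" by auto
  show "\<forall>k. ?R k"
  proof
    fix k :: nat
    define J where "J = {j::'b. to_nat j \<le> k}"
    have "finite J" unfolding J_def
      by (rule finite_imageD[of to_nat]) (auto intro: finite_subset[of _ "{..k}"])
    define U where "U = {p - 1 / Suc k<..<r + 1 / Suc k} \<inter> (\<Inter>j\<in>J. {y. \<bar>h j y\<bar> < 1 / Suc k})"
    have pos: "0 < 1 / real (Suc k)" by simp
    have "p - 1 / Suc k < c" "c < r + 1 / Suc k" using c pos by linarith+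
    then have "c \<in> U" using c(3) by (simp add: U_def)
    moreover have "open U" unfolding U_def using \<open>finite J\<close> h
      by (intro open_Int open_greaterThanLessThan open_INT ballI open_Collect_less continuous_intros)
    ultimately obtain e where e: "e > 0" "\<And>y. dist y c < e \<Longrightarrow> y \<in> U"
      unfolding open_dist by blast
    obtain s where s: "c < of_rat s" "of_rat s < c + e"
      using of_rat_dense[of c "c + e"] e by auto
    then have "of_rat s \<in> U" by (intro e) (auto simp: dist_real_def)
    then show "?R k" by (auto simp: U_def J_def)
  qed
next
  assume "\<forall>k. ?R k"
  then obtain c where c: "\<And>k. p - 1 / Suc k < of_rat (c k)" "\<And>k. of_rat (c k) < r + 1 / Suc k"
      "\<And>k j. to_nat j \<le> k \<Longrightarrow> \<bar>h j (of_rat (c k))\<bar> < 1 / Suc k"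
    by metis
  define y where "y k = (of_rat (c k) :: real)" for k
  have y: "y k \<in> {p - 1..r + 1}" for k
  proof -
    have "1 / real (Suc k) \<le> 1" by simp
    then have "p - 1 \<le> y k" "y k \<le> r + 1" using c(1,2)[of k] unfolding y_def by linarith+
    then show ?thesis by simp
  qed
  obtain l f where lf: "strict_mono (f :: nat \<Rightarrow> nat)" "(y \<circ> f) \<longlonglongrightarrow> l"
    using compact_Icc[of "p - 1" "r + 1"] y unfolding compact_def by blast
  have inv: "(\<lambda>k. 1 / real (Suc (f k))) \<longlonglongrightarrow> 0"
    using LIMSEQ_subseq_LIMSEQ[OF LIMSEQ_inverse_real_of_nat lf(1)] by (simp add: o_def inverse_eq_divide)
  have "p - 0 \<le> l"
  proof (rule LIMSEQ_le[OF tendsto_diff[OF tendsto_const inv] lf(2)])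
    show "\<exists>N. \<forall>n\<ge>N. p - 1 / real (Suc (f n)) \<le> (y \<circ> f) n"
      using c(1) by (auto simp: y_def less_imp_le simp del: of_nat_Suc)
  qed
  moreover have "l \<le> r + 0"
  proof (rule LIMSEQ_le[OF lf(2) tendsto_add[OF tendsto_const inv]])
    show "\<exists>N. \<forall>n\<ge>N. (y \<circ> f) n \<le> r + 1 / real (Suc (f n))"
      using c(2) by (auto simp: y_def less_imp_le simp del: of_nat_Suc)
  qed
  moreover have "h j l = 0" for j
  proof -
    have "(\<lambda>k. h j ((y \<circ> f) k)) \<longlonglongrightarrow> h j l"
      using h[of j] by (intro isCont_tendsto_compose[OF _ lf(2)]) (simp add: continuous_on_eq_continuous_at)
    moreover have "(\<lambda>k. h j ((y \<circ> f) k)) \<longlonglongrightarrow> 0"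
    proof (rule tendsto_rabs_zero_cancel, rule real_tendsto_sandwich[OF _ _ tendsto_const inv])
      show "\<forall>\<^sub>F k in sequentially. \<bar>h j ((y \<circ> f) k)\<bar> \<le> 1 / real (Suc (f k))"
        using eventually_ge_at_top[of "to_nat j"]
      proof eventually_elim
        case (elim k)
        \<comment> \<open>The condition on a fixed \<open>j\<close> is imposed only from stage
          \<open>to_nat j\<close> on; passing to a subsequence keeps this, as
          \<open>k \<le> f k\<close>.\<close>
        then have "to_nat j \<le> f k" using seq_suble[OF lf(1), of k] by simp
        from c(3)[OF this] show ?case by (simp add: y_def del: of_nat_Suc)
      qed
    qed simp
    ultimately show ?thesis by (rule LIMSEQ_unique)
  qed
  ultimately show ?L by (intro bexI[of _ l]) auto
qed

text \<open>Compact intervals form an intersection-stable generator of the Borel sets, so Lebesgue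
  measure restricted to \<open>E\<close> and to \<open>F\<close> is the same measure, and densities
  are unique almost everywhere.\<close>

lemma borel_eq_AE_if_interval_measures_eq:
  assumes [measurable]: "E \<in> sets borel" "F \<in> sets borel"
    and eq: "\<And>a b. measure lborel ({a..b} \<inter> E) = measure lborel ({a..b} \<inter> F)"
  shows "AE s::real in lborel. s \<in> E \<longleftrightarrow> s \<in> F"
proof -
  have fin: "emeasure lborel ({a..b} \<inter> A) < \<infinity>" for a b :: real and A
    using emeasure_mono[of "{a..b} \<inter> A" "{a..b}" lborel]
    by (cases "a \<le> b") (auto simp: less_top[symmetric] top_unique)
  have eq': "emeasure lborel ({a..b} \<inter> E) = emeasure lborel ({a..b} \<inter> F)" for a b
    using eq[of a b] fin[of a b E] fin[of a b F] by (simp add: emeasure_eq_ennreal_measure)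
  have d: "emeasure (density lborel (indicator A)) {a..b} = emeasure lborel ({a..b} \<inter> A)"
    if [measurable]: "A \<in> sets borel" for a b :: real and A
    by (subst emeasure_density) (auto simp: indicator_inter_arith[symmetric] Int_commute)
  have "density lborel (indicator E) = density lborel (indicator F)"
  proof (rule measure_eqI_generator_eq[where A = "\<lambda>n::nat. {- real n..real n}"])
    show "Int_stable (range (\<lambda>(a, b). {a..b::real}))"
      by (auto simp: Int_stable_def)
    show "sets (density lborel (indicator E)) = sigma_sets UNIV (range (\<lambda>(a, b). {a..b::real}))"
      "sets (density lborel (indicator F)) = sigma_sets UNIV (range (\<lambda>(a, b). {a..b::real}))"
      by (simp_all only: sets_density sets_lborel) (subst borel_eq_atLeastAtMost, simp)+
    show "(\<Union>n::nat. {- real n..real n}) = UNIV"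
    proof -
      have "\<exists>n::nat. - real n \<le> x \<and> x \<le> real n" for x
        using real_arch_simple[of "\<bar>x\<bar>"] by (metis abs_le_iff minus_le_iff)
      then show ?thesis by auto
    qed
  qed (use fin in \<open>auto simp: d eq' less_top[symmetric]\<close>)
  then have "AE s in lborel. indicator E s = (indicator F s :: ennreal)"
    by (intro sigma_finite_measure.density_unique[OF sigma_finite_lborel]) auto
  then show ?thesis by eventually_elim (auto split: split_indicator_asm)
qed

text \<open>Finite intersections of a countable base do the job: the Hausdorff property makes the
  base separate points, and the empty intersection contributes the whole space.\<close>

lemma standard_borel_separating_sequence:
  assumes "standard_borel M"
  shows "\<exists>A :: nat \<Rightarrow> 'a set. range A \<subseteq> sets M \<and> Int_stable (range A) \<and> space M \<in> range A \<and>
    (\<forall>y\<in>space M. \<forall>z\<in>space M. y \<noteq> z \<longrightarrow> (\<exists>n. y \<in> A n \<and> z \<notin> A n))"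
proof -
  obtain X where X: "completely_metrizable_space X" "second_countable X" "topspace X = space M"
      "sets M = sigma_sets (space M) {U. openin X U}"
    using assms unfolding standard_borel_def by auto
  obtain \<B> where \<B>: "countable \<B>" "\<And>V. V \<in> \<B> \<Longrightarrow> openin X V"
      "\<And>U x. openin X U \<Longrightarrow> x \<in> U \<Longrightarrow> \<exists>V\<in>\<B>. x \<in> V \<and> V \<subseteq> U"
    using X(2) unfolding second_countable_def by metis
  have "Hausdorff_space X"
    using X(1) by (simp add: completely_metrizable_imp_metrizable_space metrizable_imp_Hausdorff_space)
  define \<C> where "\<C> = (\<lambda>F. space M \<inter> \<Inter>F) ` {F. finite F \<and> F \<subseteq> \<B>}"
  have c: "countable \<C>" "\<C> \<noteq> {}"
    unfolding \<C>_def using countable_Collect_finite_subset[OF \<B>(1)] by (auto simp: conj_commute)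
  have r: "range (from_nat_into \<C>) = \<C>" using c by (intro range_from_nat_into)
  have B: "V \<in> sets M" if "V \<in> \<B>" for V
    using X(4) \<B>(2)[OF that] by auto
  have I: "space M \<inter> \<Inter>F \<in> sets M" if "finite F" "F \<subseteq> \<B>" for F
    using that
  proof induction
    case (insert V F)
    then have "V \<inter> (space M \<inter> \<Inter>F) \<in> sets M" using B by auto
    then show ?case by (simp add: Int_left_commute)
  qed simp
  have 1: "range (from_nat_into \<C>) \<subseteq> sets M" unfolding r using I by (auto simp: \<C>_def)
  have 2: "Int_stable (range (from_nat_into \<C>))" unfolding r
  proof (rule Int_stableI)
    fix a b assume "a \<in> \<C>" "b \<in> \<C>"
    then obtain F G where "finite F" "F \<subseteq> \<B>" "a = space M \<inter> \<Inter>F" "finite G" "G \<subseteq> \<B>" "b = space M \<inter> \<Inter>G"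
      by (auto simp: \<C>_def)
    then show "a \<inter> b \<in> \<C>" unfolding \<C>_def by (intro image_eqI[of _ _ "F \<union> G"]) auto
  qed
  have 3: "space M \<in> range (from_nat_into \<C>)" unfolding r unfolding \<C>_def by (intro image_eqI[of _ _ "{}"]) auto
  have 4: "\<exists>n. y \<in> from_nat_into \<C> n \<and> z \<notin> from_nat_into \<C> n"
    if yz: "y \<in> space M" "z \<in> space M" "y \<noteq> z" for y z
  proof -
    obtain U V where "openin X U" "openin X V" "y \<in> U" "z \<in> V" "disjnt U V"
      using \<open>Hausdorff_space X\<close> yz X(3) unfolding Hausdorff_space_def by metis
    then obtain W where "W \<in> \<B>" "y \<in> W" "z \<notin> W"
      using \<B>(3)[of U y] by (auto simp: disjnt_def)
    then have "y \<in> space M \<inter> \<Inter>{W}" "z \<notin> space M \<inter> \<Inter>{W}" "space M \<inter> \<Inter>{W} \<in> \<C>"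
      using yz unfolding \<C>_def by (auto intro!: image_eqI[of _ _ "{W}"])
    then show ?thesis using r by (metis rangeE)
  qed
  show ?thesis using 1 2 3 4 by (intro exI[of _ "from_nat_into \<C>"]) blast
qed

section \<open>Triple correlations of a flow and their mixtures\<close>

locale prob_flow = prob_space M for M :: "'a measure" +
  fixes T :: "real \<Rightarrow> 'a \<Rightarrow> 'a"
  assumes flow: "measure_preserving_flow M T"
begin

lemma T_measurable [measurable (raw)]:
  assumes "f \<in> borel_measurable N" "g \<in> measurable N M"
  shows "(\<lambda>w. T (f w) (g w)) \<in> measurable N M"
proof -
  have "(\<lambda>w. (f w, g w)) \<in> measurable N (borel \<Otimes>\<^sub>M M)" using assms by measurable
  then show ?thesis
    using flow unfolding measure_preserving_flow_def
    by (auto dest!: measurable_compose[where g = "\<lambda>(t, x). T t x"])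
qed

lemma T_space [simp]: "x \<in> space M \<Longrightarrow> T t x \<in> space M"
  using measurable_space[OF T_measurable[of "\<lambda>_. t" M "\<lambda>x. x"]] by simp

lemma T_zero [simp]: "x \<in> space M \<Longrightarrow> T 0 x = x"
  using flow by (auto simp: measure_preserving_flow_def)

lemma T_T: "x \<in> space M \<Longrightarrow> T s (T t x) = T (s + t) x"
  using flow by (auto simp: measure_preserving_flow_def)

lemma distr_T: "distr M M (T t) = M"
  using flow by (auto simp: measure_preserving_flow_def measure_preserving_def)

lemma measure_T:
  assumes [measurable]: "Measurable.pred M P"
  shows "measure M {x \<in> space M. P (T t x)} = measure M {x \<in> space M. P x}"
proof -
  have "measure M {x \<in> space M. P x} = measure (distr M M (T t)) {x \<in> space M. P x}"
    by (simp add: distr_T)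
  also have "\<dots> = measure M (T t -` {x \<in> space M. P x} \<inter> space M)"
    by (rule measure_distr) measurable
  also have "T t -` {x \<in> space M. P x} \<inter> space M = {x \<in> space M. P (T t x)}" by auto
  finally show ?thesis ..
qed

definition triple :: "real \<Rightarrow> real \<Rightarrow> 'a set \<Rightarrow> 'a set \<Rightarrow> 'a set \<Rightarrow> real" where
  "triple a b A1 A2 A3 = measure M {x \<in> space M. T a x \<in> A1 \<and> T b x \<in> A2 \<and> x \<in> A3}"

lemma measure_self_joining_flow:
  assumes "A1 \<in> sets M" "A2 \<in> sets M" "A3 \<in> sets M"
  shows "measure (self_joining M (T a) (T b)) (A1 \<times> A2 \<times> A3) = triple a b A1 A2 A3"
proof -
  have "T a \<in> measurable M M" "T b \<in> measurable M M" by measurable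
  moreover have "(T a -` A1 \<inter> space M) \<inter> (T b -` A2 \<inter> space M) \<inter> A3 =
      {x \<in> space M. T a x \<in> A1 \<and> T b x \<in> A2 \<and> x \<in> A3}"
    by auto
  ultimately show ?thesis using assms by (simp add: measure_self_joining triple_def)
qed

text \<open>Substituting \<open>T (- a) x\<close> for \<open>x\<close> makes the first coordinate
  the new base point, so the outer sets trade places. For \<open>a = 2 * b\<close> the middle time
  is the midpoint, and the new times are just the negatives of the old ones.\<close>

lemma triple_shift:
  assumes [measurable]: "A1 \<in> sets M" "A2 \<in> sets M" "A3 \<in> sets M"
  shows "triple a b A1 A2 A3 = triple (- a) (b - a) A3 A2 A1"
proof -
  have "triple a b A1 A2 A3 =
      measure M {x \<in> space M. T a (T (- a) x) \<in> A1 \<and> T b (T (- a) x) \<in> A2 \<and> T (- a) x \<in> A3}"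
    unfolding triple_def by (rule measure_T[symmetric]) measurable
  also have "\<dots> = triple (- a) (b - a) A3 A2 A1"
    unfolding triple_def by (rule arg_cong[where f = "measure M"]) (auto simp: T_T)
  finally show ?thesis .
qed

lemma triple_reversed:
  assumes S: "measure_preserving M S" and [measurable]: "S' \<in> measurable M M"
    and inv: "AE x in M. S' (S x) = x"
    and rev: "\<And>t. AE x in M. T t (S x) = S (T (- t) x)"
    and [measurable]: "A1 \<in> sets M" "A2 \<in> sets M" "A3 \<in> sets M"
  shows "triple a b (S' -` A1 \<inter> space M) (S' -` A2 \<inter> space M) (S' -` A3 \<inter> space M) =
    triple (- a) (- b) A1 A2 A3"
proof -
  have [measurable]: "S \<in> measurable M M" and dS: "distr M M S = M"
    using S by (auto simp: measure_preserving_def)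
  \<comment> \<open>The exceptional null set of \<open>inv\<close> has a null preimage under
    \<open>T t\<close>, which preserves the measure.\<close>
  have inv': "AE x in M. S' (S (T t x)) = T t x" for t
    by (rule AE_distrD[where M' = M and P = "\<lambda>y. S' (S y) = y"]) (measurable, subst distr_T, rule inv)
  let ?B = "\<lambda>A. S' -` A \<inter> space M"
  let ?P = "\<lambda>x. T a x \<in> ?B A1 \<and> T b x \<in> ?B A2 \<and> x \<in> ?B A3"
  have "triple a b (?B A1) (?B A2) (?B A3) = measure (distr M M S) {x \<in> space M. ?P x}"
    by (simp add: triple_def dS)
  also have "\<dots> = measure M (S -` {x \<in> space M. ?P x} \<inter> space M)"
    by (rule measure_distr) measurable
  also have "\<dots> = triple (- a) (- b) A1 A2 A3"
    unfolding triple_def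
  proof (rule measure_eq_AE)
    show "AE x in M. x \<in> S -` {x \<in> space M. ?P x} \<inter> space M \<longleftrightarrow>
        x \<in> {x \<in> space M. T (- a) x \<in> A1 \<and> T (- b) x \<in> A2 \<and> x \<in> A3}"
      using rev[of a] rev[of b] inv'[of "- a"] inv'[of "- b"] inv AE_space
    proof eventually_elim
      case (elim x)
      have "S y \<in> space M" if "y \<in> space M" for y
        using that by (rule measurable_space[OF \<open>S \<in> measurable M M\<close>])
      with elim show ?case by auto
    qed
  qed measurable
  finally show ?thesis .
qed

lemma nn_integral_eq_triple:
  assumes [measurable]: "A1 \<in> sets M" "A2 \<in> sets M" "A3 \<in> sets M"
  shows "(\<integral>\<^sup>+x. indicator A1 (T t x) * indicator A2 (T u x) * indicator A3 x \<partial>M) =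
    ennreal (triple t u A1 A2 A3)"
proof -
  let ?S = "{x \<in> space M. T t x \<in> A1 \<and> T u x \<in> A2 \<and> x \<in> A3}"
  have "(\<integral>\<^sup>+x. indicator A1 (T t x) * indicator A2 (T u x) * indicator A3 x \<partial>M) =
      (\<integral>\<^sup>+x. indicator ?S x \<partial>M)"
    by (intro nn_integral_cong) (auto split: split_indicator)
  also have "\<dots> = emeasure M ?S" by (rule nn_integral_indicator) measurable
  finally show ?thesis by (simp add: triple_def emeasure_eq_measure)
qed

lemma triple_measurable:
  assumes [measurable]: "A1 \<in> sets M" "A2 \<in> sets M" "A3 \<in> sets M"
  shows "(\<lambda>p :: real \<times> real. triple (fst p) (snd p) A1 A2 A3) \<in> borel_measurable borel"
proof -
  have [measurable]: "(fst :: real \<times> real \<Rightarrow> real) \<in> borel_measurable borel"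
    "(snd :: real \<times> real \<Rightarrow> real) \<in> borel_measurable borel"
    by (intro borel_measurable_continuous_onI continuous_intros)+
  have "(\<lambda>p :: real \<times> real. enn2real (\<integral>\<^sup>+x. indicator A1 (T (fst p) x) *
      indicator A2 (T (snd p) x) * indicator A3 x \<partial>M)) \<in> borel_measurable borel"
    by measurable
  then show ?thesis by (simp add: nn_integral_eq_triple triple_def)
qed

text \<open>For fixed \<open>x\<close> the integrand is the mass of the rectangle with sides
  \<open>A1\<close>, \<open>A2\<close> under the image of \<open>P\<close> by
  \<open>(t, u) \<mapsto> (T t x, T u x)\<close>. By Tonelli these images disintegrate the mixture
  of joinings over the third coordinate.\<close>

lemma
  fixes P :: "(real \<times> real) measure"
  assumes "prob_space P" and sets: "sets P = sets borel"
    and [measurable]: "A1 \<in> sets M" "A2 \<in> sets M"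
  shows emeasure_visits_measurable:
      "(\<lambda>x. emeasure P {p. T (fst p) x \<in> A1 \<and> T (snd p) x \<in> A2}) \<in> borel_measurable M"
    and nn_integral_emeasure_visits: "A3 \<in> sets M \<Longrightarrow>
      (\<integral>\<^sup>+x. emeasure P {p. T (fst p) x \<in> A1 \<and> T (snd p) x \<in> A2} * indicator A3 x \<partial>M) =
      ennreal (\<integral>(t, u). triple t u A1 A2 A3 \<partial>P)"
proof -
  interpret P: prob_space P by fact
  interpret PM: pair_sigma_finite P M ..
  have [simp]: "space P = UNIV" using sets_eq_imp_space_eq[OF sets] by simp
  have [measurable]: "fst \<in> borel_measurable P" "snd \<in> borel_measurable P"
    unfolding measurable_cong_sets[OF sets refl]
    by (intro borel_measurable_continuous_onI continuous_intros)+
  let ?R = "\<lambda>p x. indicator A1 (T (fst p) x) * indicator A2 (T (snd p) x) :: ennreal"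
  have em: "emeasure P {p. T (fst p) x \<in> A1 \<and> T (snd p) x \<in> A2} = (\<integral>\<^sup>+p. ?R p x \<partial>P)"
    if [measurable]: "x \<in> space M" for x
  proof -
    have "{p \<in> space P. T (fst p) x \<in> A1 \<and> T (snd p) x \<in> A2} \<in> sets P" by measurable
    then have "emeasure P {p. T (fst p) x \<in> A1 \<and> T (snd p) x \<in> A2} =
        (\<integral>\<^sup>+p. indicator {p. T (fst p) x \<in> A1 \<and> T (snd p) x \<in> A2} p \<partial>P)" by simp
    also have "\<dots> = (\<integral>\<^sup>+p. ?R p x \<partial>P)"
      by (intro nn_integral_cong) (auto split: split_indicator)
    finally show ?thesis .
  qed
  show "(\<lambda>x. emeasure P {p. T (fst p) x \<in> A1 \<and> T (snd p) x \<in> A2}) \<in> borel_measurable M"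
    by (subst measurable_cong[OF em]) measurable
  show "(\<integral>\<^sup>+x. emeasure P {p. T (fst p) x \<in> A1 \<and> T (snd p) x \<in> A2} * indicator A3 x \<partial>M) =
      ennreal (\<integral>(t, u). triple t u A1 A2 A3 \<partial>P)" if A3 [measurable]: "A3 \<in> sets M"
  proof -
    have "(\<lambda>p. triple (fst p) (snd p) A1 A2 A3) \<in> borel_measurable P"
      unfolding measurable_cong_sets[OF sets refl] by (rule triple_measurable) fact+
    then have int: "integrable P (\<lambda>p. triple (fst p) (snd p) A1 A2 A3)"
      by (intro P.integrable_const_bound[where B = 1]) (auto simp: triple_def)
    have "(\<integral>\<^sup>+x. emeasure P {p. T (fst p) x \<in> A1 \<and> T (snd p) x \<in> A2} * indicator A3 x \<partial>M) =
        (\<integral>\<^sup>+x. \<integral>\<^sup>+p. ?R p x * indicator A3 x \<partial>P \<partial>M)"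
      by (intro nn_integral_cong, subst em, simp, subst nn_integral_multc[symmetric]) measurable
    also have "\<dots> = (\<integral>\<^sup>+p. \<integral>\<^sup>+x. ?R p x * indicator A3 x \<partial>M \<partial>P)"
      by (rule PM.Fubini'[of "\<lambda>p x. ?R p x * indicator A3 x"]) measurable
    also have "\<dots> = ennreal (\<integral>p. triple (fst p) (snd p) A1 A2 A3 \<partial>P)"
      using int by (simp add: nn_integral_eq_triple nn_integral_eq_integral triple_def)
    finally show ?thesis by (simp add: case_prod_unfold)
  qed
qed

section \<open>Occupation times of orbits\<close>

text \<open>Orbit maps are only measurable in time. Integrating over a time window gives a quantity
  that is Lipschitz in the end points and measurable in \<open>x\<close>.\<close>

definition occ :: "'a set \<Rightarrow> 'a \<Rightarrow> real \<Rightarrow> real \<Rightarrow> real" where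
  "occ A x a b = measure lborel ({a..b} \<inter> {s. T s x \<in> A})"

lemma visit_times_borel [measurable]:
  assumes [measurable]: "A \<in> sets M" "x \<in> space M"
  shows "{s. T s x \<in> A} \<in> sets borel"
proof -
  have "{s \<in> space borel. T s x \<in> A} \<in> sets borel" by measurable
  then show ?thesis by simp
qed

lemma occ_measurable [measurable]:
  assumes [measurable]: "A \<in> sets M"
  shows "(\<lambda>x. occ A x a b) \<in> borel_measurable M"
proof -
  have "occ A x a b = enn2real (\<integral>\<^sup>+s. indicator {a..b} s * indicator A (T s x) \<partial>lborel)"
    if [measurable]: "x \<in> space M" for x
  proof -
    have "emeasure lborel ({a..b} \<inter> {s. T s x \<in> A}) =
        (\<integral>\<^sup>+s. indicator ({a..b} \<inter> {s. T s x \<in> A}) s \<partial>lborel)"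
      by (rule nn_integral_indicator[symmetric]) measurable
    also have "\<dots> = (\<integral>\<^sup>+s. indicator {a..b} s * indicator A (T s x) \<partial>lborel)"
      by (intro nn_integral_cong) (auto split: split_indicator)
    finally show ?thesis by (simp add: occ_def measure_def)
  qed
  then show ?thesis by (subst measurable_cong) measurable
qed

lemma occ_T:
  assumes [measurable]: "A \<in> sets M" "x \<in> space M"
  shows "occ A (T t x) a b = occ A x (a + t) (b + t)"
proof -
  let ?X = "{a + t..b + t} \<inter> {s. T s x \<in> A}"
  have "occ A x (a + t) (b + t) = measure (distr lborel borel ((+) t)) ?X"
    by (simp add: occ_def lborel_distr_plus)
  also have "\<dots> = measure lborel ((+) t -` ?X \<inter> space lborel)"
    by (rule measure_distr) measurable
  also have "(+) t -` ?X \<inter> space lborel = {a..b} \<inter> {s. T s (T t x) \<in> A}"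
    using assms(2) by (auto simp: T_T add.commute)
  finally show ?thesis by (simp add: occ_def)
qed

lemma occ_le:
  assumes [measurable]: "A \<in> sets M" "x \<in> space M"
  shows "occ A x a' b' \<le> occ A x a b + \<bar>a' - a\<bar> + \<bar>b' - b\<bar>"
proof -
  let ?E = "{s. T s x \<in> A}" and ?I = "{min a a'..max a a'}" and ?J = "{min b b'..max b b'}"
  have "emeasure lborel ({u..v} \<inter> ?E) < \<infinity>" for u v
    by (rule le_less_trans[OF emeasure_mono[of _ "{u..v}"]]) (auto simp: emeasure_lborel_Icc_eq)
  then have fin: "{u..v} \<inter> ?E \<in> fmeasurable lborel" for u v
    by (intro fmeasurableI) auto
  have fin': "{u..v::real} \<in> fmeasurable lborel" for u v
    by (intro fmeasurableI) (auto simp: emeasure_lborel_Icc_eq)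
  \<comment> \<open>A point of \<open>{a'..b'}\<close> outside \<open>{a..b}\<close> lies between
    the two left or between the two right end points; this also holds when \<open>{a..b}\<close> is
    empty.\<close>
  have "occ A x a' b' \<le> measure lborel (({a..b} \<inter> ?E) \<union> ?I \<union> ?J)"
    unfolding occ_def by (intro measure_mono_fmeasurable fmeasurable.Un fin fin') auto
  also have "\<dots> \<le> measure lborel (({a..b} \<inter> ?E) \<union> ?I) + measure lborel ?J"
    by (intro measure_Un_le) auto
  also have "\<dots> \<le> measure lborel ({a..b} \<inter> ?E) + measure lborel ?I + measure lborel ?J"
    by (intro add_right_mono measure_Un_le) auto
  also have "\<dots> = occ A x a b + \<bar>a' - a\<bar> + \<bar>b' - b\<bar>"
    by (auto simp: occ_def min_def max_def)
  finally show ?thesis .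
qed

lemma occ_lipschitz:
  assumes "A \<in> sets M" "x \<in> space M"
  shows "\<bar>occ A x a' b' - occ A x a b\<bar> \<le> \<bar>a' - a\<bar> + \<bar>b' - b\<bar>"
  using occ_le[OF assms, of a' b' a b] occ_le[OF assms, of a b a' b'] by linarith

end

section \<open>Stabilizers of points and almost everywhere freeness\<close>

locale separated_flow = prob_flow +
  fixes A :: "nat \<Rightarrow> 'a set"
  assumes A_sets [measurable]: "A n \<in> sets M"
    and A_Int_stable: "Int_stable (range A)"
    and A_space: "space M \<in> range A"
    and A_separates: "\<And>y z. y \<in> space M \<Longrightarrow> z \<in> space M \<Longrightarrow> y \<noteq> z \<Longrightarrow> \<exists>n. y \<in> A n \<and> z \<notin> A n"
begin

text \<open>
  The functions \<open>defect x j\<close> are continuous even though the orbit map need not be, and their common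
  zeros are the periods of \<open>x\<close>. Rational end points make them a countable family.
\<close>
definition defect :: "'a \<Rightarrow> nat \<times> rat \<times> rat \<Rightarrow> real \<Rightarrow> real" where
  "defect x j c = occ (A (fst j)) x (of_rat (fst (snd j)) + c) (of_rat (snd (snd j)) + c) -
    occ (A (fst j)) x (of_rat (fst (snd j))) (of_rat (snd (snd j)))"

lemma defect_measurable [measurable]: "(\<lambda>x. defect x j c) \<in> borel_measurable M"
  unfolding defect_def by measurable

lemma continuous_defect:
  assumes "x \<in> space M"
  shows "continuous_on UNIV (defect x j)"
proof -
  have "\<bar>defect x j c - defect x j c'\<bar> \<le> 2 * \<bar>c - c'\<bar>" for c c'
    using occ_lipschitz[OF A_sets assms, of "fst j" "of_rat (fst (snd j)) + c" "of_rat (snd (snd j)) + c"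
        "of_rat (fst (snd j)) + c'" "of_rat (snd (snd j)) + c'"]
    by (simp add: defect_def)
  then have "2-lipschitz_on UNIV (defect x j)"
    by (intro lipschitz_onI) (auto simp: dist_real_def)
  then show ?thesis by (rule lipschitz_on_continuous_on)
qed

text \<open>If all defects vanish, \<open>T c x\<close> and \<open>x\<close> have equal occupation
  times on rational windows, hence by continuity on all windows. Their visit times to every
  \<open>A n\<close> then agree almost everywhere, simultaneously in \<open>n\<close>. At one such
  time \<open>s\<close> no \<open>A n\<close> separates the two orbit points, so they coincide, and
  applying \<open>T (- s)\<close> returns to \<open>x\<close>.\<close>

lemma T_eq_self_iff_defect:
  assumes x [measurable]: "x \<in> space M"
  shows "T c x = x \<longleftrightarrow> (\<forall>j. defect x j c = 0)"
proof
  assume "T c x = x"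
  then show "\<forall>j. defect x j c = 0"
    using occ_T[OF A_sets x, of _ c] by (simp add: defect_def)
next
  assume d: "\<forall>j. defect x j c = 0"
  have eq: "occ (A n) (T c x) a b = occ (A n) x a b" for n a b
  proof (rule ccontr)
    \<comment> \<open>Both occupation times move by less than \<open>2 * e\<close> on passing to the
      rational window, so a quarter of the difference is small enough.\<close>
    define e where "e = \<bar>occ (A n) (T c x) a b - occ (A n) x a b\<bar> / 4"
    assume "occ (A n) (T c x) a b \<noteq> occ (A n) x a b"
    then have "e > 0" by (simp add: e_def)
    then obtain a' b' where ab: "a < of_rat a'" "of_rat a' < a + e" "b < of_rat b'" "of_rat b' < b + e"
      using of_rat_dense[of a "a + e"] of_rat_dense[of b "b + e"] by auto
    have "occ (A n) (T c x) (of_rat a') (of_rat b') = occ (A n) x (of_rat a') (of_rat b')"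
      using d[rule_format, of "(n, a', b')"] occ_T[OF A_sets x] by (simp add: defect_def)
    moreover have "\<bar>of_rat a' - a\<bar> < e" "\<bar>of_rat b' - b\<bar> < e" using ab by linarith+
    ultimately have "\<bar>occ (A n) (T c x) a b - occ (A n) x a b\<bar> < 4 * e"
      using occ_lipschitz[OF A_sets x, of n "of_rat a'" "of_rat b'" a b]
        occ_lipschitz[OF A_sets T_space[OF x], of n c "of_rat a'" "of_rat b'" a b] by linarith
    then show False by (simp add: e_def)
  qed
  have "AE s in lborel. \<forall>n. s \<in> {s. T s (T c x) \<in> A n} \<longleftrightarrow> s \<in> {s. T s x \<in> A n}"
    unfolding AE_all_countable
    by (intro allI borel_eq_AE_if_interval_measures_eq) (use eq in \<open>auto simp: occ_def\<close>)
  \<comment> \<open>Lebesgue measure is not zero, so an almost everywhere statement has a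
    witness.\<close>
  moreover have "\<not> (AE s::real in lborel. False)"
    by (auto elim!: AE_E simp: top.extremum_unique)
  ultimately obtain s where s: "\<And>n. T s (T c x) \<in> A n \<longleftrightarrow> T s x \<in> A n"
    by (smt (verit) eventually_mono mem_Collect_eq)
  then have "T s (T c x) = T s x" using A_separates x by (metis T_space)
  then have "T (- s) (T s (T c x)) = T (- s) (T s x)" by simp
  then show "T c x = x" using x by (simp add: T_T)
qed

lemma closed_stabilizer:
  assumes "x \<in> space M"
  shows "closed {c. T c x = x}"
proof -
  have "{c. T c x = x} = (\<Inter>j. {c. defect x j c = 0})"
    using T_eq_self_iff_defect[OF assms] by blast
  moreover have "closed {c. defect x j c = 0}" for j
    using continuous_defect[OF assms] continuous_on_const by (rule closed_Collect_eq)
  ultimately show ?thesis by (metis closed_INT)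
qed

definition returning :: "real \<Rightarrow> real \<Rightarrow> 'a set" where
  "returning p r = {x \<in> space M. \<exists>c\<in>{p..r}. T c x = x}"

lemma returning_sets [measurable]: "returning p r \<in> sets M"
proof -
  have "returning p r = {x \<in> space M. \<forall>k::nat. \<exists>c::rat. p - 1 / Suc k < of_rat c \<and>
      of_rat c < r + 1 / Suc k \<and> (\<forall>j. to_nat j \<le> k \<longrightarrow> \<bar>defect x j (of_rat c)\<bar> < 1 / Suc k)}"
    unfolding returning_def
    by (intro Collect_cong conj_cong refl)
      (simp only: T_eq_self_iff_defect common_zero_iff_rational_approx[OF continuous_defect])
  also have "\<dots> \<in> sets M" by measurable
  finally show ?thesis .
qed

lemma T_eq_self_T_iff: "x \<in> space M \<Longrightarrow> T c (T t x) = T t x \<longleftrightarrow> T c x = x"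
proof
  assume x: "x \<in> space M" and "T c (T t x) = T t x"
  then have "T (- t) (T c (T t x)) = T (- t) (T t x)" by simp
  with x show "T c x = x" by (simp add: T_T)
next
  assume x: "x \<in> space M" and "T c x = x"
  then have "T t (T c x) = T t x" by simp
  with x show "T c (T t x) = T t x" by (simp add: T_T add.commute)
qed

text \<open>Aperiodicity treats one period at a time, while here a union over uncountably many
  \<open>c\<close> must be null. The sets \<open>returning p r\<close> bridge the gap: they are
  measurable, and invariant because all points of an orbit share one stabilizer, so each has measure
  0 or 1.\<close>

lemma AE_free:
  assumes "ergodic_flow M T" "aperiodic_flow M T"
  shows "AE x in M. \<forall>c. c \<noteq> 0 \<longrightarrow> T c x \<noteq> x"
proof -
  have zero_one: "measure M (returning p r) = 0 \<or> measure M (returning p r) = 1" for p r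
  proof -
    have "T t -` returning p r \<inter> space M = returning p r" for t
      by (auto simp: returning_def T_eq_self_T_iff)
    then show ?thesis using assms(1) by (simp add: ergodic_flow_def)
  qed
  \<comment> \<open>Bisection reduces this to short intervals around each point \<open>c\<close>.
    The sets for intervals shrinking to \<open>c\<close> decrease into the fixed points of
    \<open>T c\<close>, since stabilizers are closed. Their measures tend to 0, so one drops below 1
    and is then 0. Positivity of \<open>p\<close> excludes the trivial period.\<close>
  have null: "measure M (returning p r) = 0" if "0 < p" "p \<le> r" for p r
    using that(2)
  proof (induction p r rule: Bolzano)
    case (trans a b c)
    have "returning a c \<subseteq> returning a b \<union> returning b c"
      by (auto simp: returning_def) (meson atLeastAtMost_iff linear)
    then have "measure M (returning a c) \<le> measure M (returning a b) + measure M (returning b c)"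
      by (intro order_trans[OF finite_measure_mono measure_Un_le]) auto
    then show ?case using trans by (simp add: measure_le_0_iff)
  next
    case (local c)
    define B where "B k = returning (c - 1 / Suc k) (c + 1 / Suc k)" for k
    have mono: "returning a b \<subseteq> returning a' b'" if "a' \<le> a" "b \<le> b'" for a b a' b'
      using that by (force simp: returning_def)
    have "decseq B" unfolding B_def decseq_def
      by (intro allI impI mono) (auto intro!: divide_left_mono)
    moreover have "range B \<subseteq> sets M" by (auto simp: B_def)
    ultimately have "(\<lambda>k. measure M (B k)) \<longlonglongrightarrow> measure M (\<Inter>k. B k)"
      by (intro finite_Lim_measure_decseq)
    moreover have "(\<Inter>k. B k) \<subseteq> {x \<in> space M. T c x = x}"
    proof
      fix x assume xB: "x \<in> (\<Inter>k. B k)"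
      then have x: "x \<in> space M" by (auto simp: B_def returning_def)
      from xB have "\<forall>k. \<exists>s. c - 1 / Suc k \<le> s \<and> s \<le> c + 1 / Suc k \<and> T s x = x"
        by (simp add: B_def returning_def Bex_def conj_assoc del: of_nat_Suc)
      then obtain s where s: "\<And>k. c - 1 / Suc k \<le> s k" "\<And>k. s k \<le> c + 1 / Suc k" "\<And>k. T (s k) x = x"
        by metis
      have inv: "(\<lambda>k. 1 / real (Suc k)) \<longlonglongrightarrow> 0"
        using LIMSEQ_inverse_real_of_nat by (simp add: inverse_eq_divide)
      have "s \<longlonglongrightarrow> c"
      proof (rule real_tendsto_sandwich)
        show "(\<lambda>k. c - 1 / real (Suc k)) \<longlonglongrightarrow> c" "(\<lambda>k. c + 1 / real (Suc k)) \<longlonglongrightarrow> c"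
          using tendsto_diff[OF tendsto_const[of c] inv] tendsto_add[OF tendsto_const[of c] inv]
          by (simp_all only: diff_0_right add_0_right)
      qed (use s(1,2) in \<open>simp_all only: eventually_True\<close>)
      then have "c \<in> {c. T c x = x}"
        using closed_stabilizer[OF x] s(3) by (auto simp: closed_sequential_limits)
      with x show "x \<in> {x \<in> space M. T c x = x}" by simp
    qed
    moreover have "{x \<in> space M. T c x = x} \<in> null_sets M"
      using assms(2) local that(1) by (auto simp: aperiodic_flow_def)
    moreover have "(\<Inter>k. B k) \<in> sets M"
      by (rule sets.countable_INT) (auto simp: B_def)
    ultimately have "(\<lambda>k. measure M (B k)) \<longlonglongrightarrow> 0"
      using measure_eq_0_null_sets[OF null_sets_subset] by metis
    then have "\<forall>\<^sub>F k in sequentially. measure M (B k) < 1"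
      by (rule order_tendstoD) simp
    then obtain k where "measure M (B k) < 1" by (auto simp: eventually_sequentially)
    then have k: "measure M (B k) = 0" using zero_one unfolding B_def by fastforce
    show ?case
    proof (intro exI[of _ "1 / real (Suc k)"] conjI allI impI)
      fix a b assume "a \<le> c \<and> c \<le> b \<and> b - a < 1 / real (Suc k)"
      then have "returning a b \<subseteq> B k" unfolding B_def by (intro mono) linarith+
      then have "measure M (returning a b) \<le> measure M (B k)"
        by (intro finite_measure_mono) (auto simp: B_def)
      with k show "measure M (returning a b) = 0" by (simp add: measure_le_0_iff)
    qed simp
  qed
  \<comment> \<open>These intervals exhaust the positive reals; negative periods reduce to positive
    ones by inverting.\<close>
  have "AE x in M. \<forall>n. x \<notin> returning (1 / Suc n) (Suc n)"
    unfolding AE_all_countable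
  proof
    fix n
    have "1 / real (Suc n) \<le> 1" "1 \<le> real (Suc n)" by simp_all
    then have "1 / real (Suc n) \<le> real (Suc n)" by linarith
    then have "returning (1 / Suc n) (Suc n) \<in> null_sets M"
      using null[of "1 / Suc n" "Suc n"] by (auto simp: emeasure_eq_measure simp del: of_nat_Suc intro!: null_setsI)
    then show "AE x in M. x \<notin> returning (1 / Suc n) (Suc n)" by (rule AE_not_in)
  qed
  then show ?thesis using AE_space
  proof eventually_elim
    case (elim x)
    have pos: "T c x \<noteq> x" if c: "c > 0" for c
    proof
      assume "T c x = x"
      obtain m where m: "inverse (real (Suc m)) < c" using reals_Archimedean[OF c] by blast
      obtain l where l: "c \<le> real l" using real_arch_simple by blast
      let ?n = "max m l"
      have "1 / real (Suc ?n) \<le> inverse (real (Suc m))"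
        by (simp add: inverse_eq_divide divide_left_mono)
      then have "c \<in> {1 / Suc ?n..Suc ?n}" using m l by auto
      then have "x \<in> returning (1 / Suc ?n) (Suc ?n)"
        using \<open>T c x = x\<close> elim unfolding returning_def by blast
      with elim show False by blast
    qed
    have "T c x \<noteq> x" if "c < 0" for c
    proof
      assume "T c x = x"
      then have "T (- c) (T c x) = T (- c) x" by simp
      with elim have "T (- c) x = x" by (simp add: T_T)
      with pos[of "- c"] that show False by simp
    qed
    with pos show ?case by (meson linorder_neqE_linordered_idom)
  qed
qed
end

section \<open>Uniqueness of the mixing measure\<close>

text \<open>Varying \<open>A3\<close> identifies the rectangle masses at almost every
  \<open>x\<close>, for all pairs from the countable family at once. At a free point the orbit map
  is injective, so the visit sets \<open>R x m n\<close> separate the points of the plane and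
  determine the measure.\<close>

lemma (in separated_flow) mixture_unique:
  fixes P1 P2 :: "(real \<times> real) measure"
  assumes "prob_space P1" "prob_space P2"
    and sets: "sets P1 = sets borel" "sets P2 = sets borel"
    and free: "AE x in M. \<forall>c. c \<noteq> 0 \<longrightarrow> T c x \<noteq> x"
    and eq: "\<And>A1 A2 A3. A1 \<in> sets M \<Longrightarrow> A2 \<in> sets M \<Longrightarrow> A3 \<in> sets M \<Longrightarrow>
      (\<integral>(t, u). triple t u A1 A2 A3 \<partial>P1) = (\<integral>(t, u). triple t u A1 A2 A3 \<partial>P2)"
  shows "P1 = P2"
proof -
  interpret P1: prob_space P1 by fact
  interpret P2: prob_space P2 by fact
  define R where "R x m n = {p. T (fst p) x \<in> A m \<and> T (snd p) x \<in> A n}" for x and m n :: nat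
  have R_borel: "R x m n \<in> sets borel" if [measurable]: "x \<in> space M" for x m n
  proof -
    have [measurable]: "(fst :: real \<times> real \<Rightarrow> real) \<in> borel_measurable borel"
      "(snd :: real \<times> real \<Rightarrow> real) \<in> borel_measurable borel"
      by (intro borel_measurable_continuous_onI continuous_intros)+
    have "{p \<in> space (borel :: (real \<times> real) measure). T (fst p) x \<in> A m \<and> T (snd p) x \<in> A n} \<in> sets borel"
      by measurable
    then show ?thesis by (simp add: R_def)
  qed
  have "AE x in M. \<forall>m n. emeasure P1 (R x m n) = emeasure P2 (R x m n)"
    unfolding AE_all_countable R_def
    by (intro allI density_unique_finite_measure emeasure_visits_measurable)
      (use assms(1,2) sets eq in \<open>simp_all add: nn_integral_emeasure_visits\<close>)
  \<comment> \<open>The conclusion does not mention \<open>x\<close>: one good point suffices, and a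
    probability space has one.\<close>
  with free AE_space have "AE x in M. P1 = P2"
  proof eventually_elim
    case (elim x)
    let ?G = "range (\<lambda>(m, n). R x m n)"
    have inj: "t = t'" if "T t x = T t' x" for t t'
    proof -
      have "T (- t') (T t x) = T (- t') (T t' x)" using that by simp
      with elim(2) have "T (t - t') x = x" by (simp add: T_T)
      with elim(1) have "t - t' = 0" by blast
      then show ?thesis by simp
    qed
    obtain k where k: "A k = space M" using A_space by auto
    show "P1 = P2"
    proof (rule borel_measure_eqI_separating[where \<G> = ?G])
      show "Int_stable ?G"
      proof (rule Int_stableI)
        fix G G' assume "G \<in> ?G" "G' \<in> ?G"
        then obtain m n m' n' where G: "G = R x m n" "G' = R x m' n'" by auto
        have "A m \<inter> A m' \<in> range A" "A n \<inter> A n' \<in> range A"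
          using A_Int_stable by (auto dest!: Int_stableD)
        then obtain i j where "A m \<inter> A m' = A i" "A n \<inter> A n' = A j" by auto
        then have "G \<inter> G' = R x i j" unfolding G R_def by auto
        then show "G \<inter> G' \<in> ?G" by auto
      qed
      \<comment> \<open>With \<open>A k\<close> the whole space, \<open>R x m k\<close> and
        \<open>R x k n\<close> test one coordinate alone.\<close>
      have "R x k k = UNIV" using elim(2) k by (auto simp: R_def)
      then show "UNIV \<in> ?G" by (metis (mono_tags, lifting) case_prod_conv range_eqI)
      show "\<exists>G\<in>?G. y \<in> G \<and> z \<notin> G" if "y \<noteq> z" for y z
      proof (cases "fst y = fst z")
        case False
        then obtain m where "T (fst y) x \<in> A m" "T (fst z) x \<notin> A m"
          using A_separates[of "T (fst y) x" "T (fst z) x"] inj elim(2) by auto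
        then have "y \<in> R x m k" "z \<notin> R x m k" using k elim(2) by (auto simp: R_def)
        then show ?thesis by auto
      next
        case True
        with that have "snd y \<noteq> snd z" by (auto simp: prod_eq_iff)
        then obtain n where "T (snd y) x \<in> A n" "T (snd z) x \<notin> A n"
          using A_separates[of "T (snd y) x" "T (snd z) x"] inj elim(2) by auto
        then have "y \<in> R x k n" "z \<notin> R x k n" using k elim(2) by (auto simp: R_def)
        then show ?thesis by auto
      qed
      show "measure P1 G = measure P2 G" if "G \<in> ?G" for G
        using that elim(3) by (auto simp: measure_def)
    qed (use sets R_borel elim(2) P1.finite_measure_axioms P2.finite_measure_axioms in auto)
  qed
  then show ?thesis using not_empty by (auto simp: AE_const split: if_splits)
qed

section \<open>Reversing automorphisms and the limit joining\<close>

text \<open>The preimages under \<open>S'\<close> play the role of the images under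
  \<open>S\<close>. On them \<open>S\<close> reverses the times \<open>2 * q n\<close> and
  \<open>q n\<close>, and a shift restores both times while exchanging the outer sets. One sequence
  thus has two expressions for its limit.\<close>

lemma (in prob_flow) limit_invariant:
  fixes Q :: "(real \<times> real) measure"
  assumes sets: "sets Q = sets borel"
    and lim: "\<And>A1 A2 A3. A1 \<in> sets M \<Longrightarrow> A2 \<in> sets M \<Longrightarrow> A3 \<in> sets M \<Longrightarrow>
      (\<lambda>n. triple (2 * q n) (q n) A1 A2 A3) \<longlonglongrightarrow> (\<integral>(t, u). triple (- t) (- u) A1 A2 A3 \<partial>Q)"
    and iso: "isomorphic_to_inverse M T"
    and A [measurable]: "A1 \<in> sets M" "A2 \<in> sets M" "A3 \<in> sets M"
  shows "(\<integral>(t, u). triple t u A1 A2 A3 \<partial>Q) = (\<integral>(t, u). triple t (t - u) A1 A2 A3 \<partial>Q)"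
proof -
  obtain S S' where S: "measure_preserving M S" and [measurable]: "S' \<in> measurable M M"
      and "AE x in M. S' (S x) = x" "\<And>t. AE x in M. T t (S x) = S (T (- t) x)"
    using iso unfolding isomorphic_to_inverse_def by blast
  note rev = triple_reversed[OF this A]
  let ?B = "\<lambda>A. S' -` A \<inter> space M"
  have "(\<lambda>n. triple (2 * q n) (q n) (?B A1) (?B A2) (?B A3))
      \<longlonglongrightarrow> (\<integral>(t, u). triple (- t) (- u) (?B A1) (?B A2) (?B A3) \<partial>Q)"
    by (intro lim) measurable
  moreover have "triple (2 * q n) (q n) (?B A1) (?B A2) (?B A3) = triple (2 * q n) (q n) A3 A2 A1" for n
    unfolding rev by (subst triple_shift) (use A in auto)
  ultimately have "(\<integral>(t, u). triple (- t) (- u) (?B A1) (?B A2) (?B A3) \<partial>Q) =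
      (\<integral>(t, u). triple (- t) (- u) A3 A2 A1 \<partial>Q)"
    using LIMSEQ_unique lim[OF A(3,2,1)] by simp
  \<comment> \<open>In the limit, undoing the exchange of the outer sets costs the change of times
    \<open>(t, u) \<mapsto> (t, t - u)\<close>.\<close>
  moreover have "triple (- t) (- u) A3 A2 A1 = triple t (t - u) A1 A2 A3" for t u
    by (subst triple_shift) (use A in auto)
  ultimately show ?thesis by (simp add: rev)
qed

theorem corollary3p13:
  fixes M :: "'a measure" and T :: "real \<Rightarrow> 'a \<Rightarrow> 'a"
    and q :: "nat \<Rightarrow> real" and Q :: "(real \<times> real) measure"
  assumes "prob_space M" and "standard_borel M"
    and "measure_preserving_flow M T" and "ergodic_flow M T" and "aperiodic_flow M T"
    and "prob_space Q" and "sets Q = sets borel"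
    and "\<And>A1 A2 A3. A1 \<in> sets M \<Longrightarrow> A2 \<in> sets M \<Longrightarrow> A3 \<in> sets M \<Longrightarrow>
      (\<lambda>n. measure (self_joining M (T (2 * q n)) (T (q n))) (A1 \<times> A2 \<times> A3))
        \<longlonglongrightarrow> (\<integral>(t, u). measure (self_joining M (T (- t)) (T (- u))) (A1 \<times> A2 \<times> A3) \<partial>Q)"
  shows "(distr Q borel (\<lambda>(t, u). (t, t - u)) \<noteq> Q \<longrightarrow> \<not> isomorphic_to_inverse M T) \<and>
    ((\<exists>x. measure Q {(0, x)} > 0 \<and> \<not> measure Q {(0, - x)} > 0) \<longrightarrow>
      \<not> isomorphic_to_inverse M T)"
proof -
  interpret prob_flow M T
    using assms(1,3) by (simp add: prob_flow_def prob_flow_axioms_def)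
  interpret Q: prob_space Q by fact
  obtain A :: "nat \<Rightarrow> 'a set" where A: "range A \<subseteq> sets M" "Int_stable (range A)" "space M \<in> range A"
    "\<And>y z. y \<in> space M \<Longrightarrow> z \<in> space M \<Longrightarrow> y \<noteq> z \<Longrightarrow> \<exists>n. y \<in> A n \<and> z \<notin> A n"
    using standard_borel_separating_sequence[OF assms(2)] by metis
  interpret separated_flow M T A
    using A(1) by unfold_locales (blast intro: A(2-4))+
  let ?\<theta> = "\<lambda>(t::real, u::real). (t, t - u)"
  have \<theta>: "?\<theta> \<in> measurable Q borel"
    unfolding measurable_cong_sets[OF assms(7) refl] case_prod_unfold
    by (intro borel_measurable_continuous_onI continuous_intros)
  have invariant: "distr Q borel ?\<theta> = Q" if "isomorphic_to_inverse M T"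
  proof (rule mixture_unique[OF Q.prob_space_distr[OF \<theta>] assms(6) _ assms(7) AE_free[OF assms(4,5)]])
    fix A1 A2 A3 assume A: "A1 \<in> sets M" "A2 \<in> sets M" "A3 \<in> sets M"
    have "(\<integral>(t, u). triple t u A1 A2 A3 \<partial>Q) = (\<integral>(t, u). triple t (t - u) A1 A2 A3 \<partial>Q)"
      using assms(8) by (intro limit_invariant[OF assms(7) _ that A]) (simp add: measure_self_joining_flow)
    also have "\<dots> = (\<integral>(t, u). triple t u A1 A2 A3 \<partial>distr Q borel ?\<theta>)"
      by (subst integral_distr[OF \<theta>]) (use triple_measurable[OF A] in \<open>simp_all add: case_prod_unfold\<close>)
    finally show "(\<integral>(t, u). triple t u A1 A2 A3 \<partial>distr Q borel ?\<theta>) = (\<integral>(t, u). triple t u A1 A2 A3 \<partial>Q)" ..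
  qed simp
  \<comment> \<open>The injective map \<open>?\<theta>\<close> sends \<open>(0, x)\<close> to
    \<open>(0, - x)\<close>, so invariance gives both points the same mass.\<close>
  have atom: "measure Q {(0, x)} = measure Q {(0, - x)}" if "distr Q borel ?\<theta> = Q" for x
  proof -
    have "measure Q {(0, - x)} = measure (distr Q borel ?\<theta>) {(0, - x)}" by (simp add: that)
    also have "\<dots> = measure Q (?\<theta> -` {(0, - x)} \<inter> space Q)"
      by (rule measure_distr[OF \<theta>]) simp
    also have "?\<theta> -` {(0, - x)} \<inter> space Q = {(0, x)}"
      using sets_eq_imp_space_eq[OF assms(7)] by auto
    finally show ?thesis ..
  qed
  show ?thesis
  proof (cases "isomorphic_to_inverse M T")
    case True
    note inv = invariant[OF this]
    show ?thesis using inv atom[OF inv] by simp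
  qed simp
qed

end
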